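(* Consider an instance of the alternating-current optimal power flow problem (as in the context) such that there exists an optimum solution $W^*$ of [LL] with rank $1$ and $c^2_k\ge 0$ for all $k\in G$. Let $R^{(k)}\in\mathbb R^{n\times 1}$ be an iterate produced by the low-rank coordinate descent algorithm (described in the context) when run with $r=1$, and suppose moreover that $T_k(R^{(k)})=0$. If $RR^T$, where $R=[R^{(k)},\mathbf 0]\in\mathbb R^{n\times 2}$, is a local optimum of [R$2$BC], then $R^{(k)}(R^{(k)})^T$ is a global optimum solution of [R$1$BC] and of [PP4] (for [PP4], meaning that $x=R^{(k)}$ is a global optimum).
   Context: Instance data. A network has a finite set $N=\{1,\dots,|N|\}$ of buses, branches $L\subseteq N\times N$, and generators $G\subseteq N$; set $n=2|N|$. Real data: cost coefficients $c^0_k,c^1_k,c^2_k$ ($k\in G$), loads $P^d_k,Q^d_k$ ($k\in N$), bounds $P_k^{\min},P_k^{\max},Q_k^{\min},Q_k^{\max}$ ($k\in G$), voltage bounds $V_k^{\min},V_k^{\max}$ ($k\in N$), branch limits $S_{lm}^{\max}$ and branch parameters $\bar b_{lm},g_{lm},b_{lm}$ ($(l,m)\in L$); and the network admittance matrix $y\in\mathbb C^{|N|\times|N|}$. The instance is assumed feasible. With $j=\sqrt{-1}$ and $e_k$ the $k$-th standard basis vector of $\mathbb R^{|N|}$, put $y_k=e_ke_k^Ty$, $y_{lm}=(j\tfrac{\bar b_{lm}}2+g_{lm}+jb_{lm})e_le_l^T-(g_{lm}+jb_{lm})e_le_m^T$, and, for $\ast=k$ or $\ast=lm$, define the real $n\times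 n$ matrices $$Y_\ast=\tfrac12\begin{pmatrix}\Re(y_\ast+y_\ast^T)&\Im(y_\ast^T-y_\ast)\\ \Im(y_\ast-y_\ast^T)&\Re(y_\ast+y_\ast^T)\end{pmatrix},\quad \bar Y_\ast=-\tfrac12\begin{pmatrix}\Im(y_\ast+y_\ast^T)&\Re(y_\ast-y_\ast^T)\\ \Re(y_\ast^T-y_\ast)&\Im(y_\ast+y_\ast^T)\end{pmatrix},\quad M_k=\begin{pmatrix}e_ke_k^T&0\\0&e_ke_k^T\end{pmatrix}.$$ Let $f_k(W)=c^2_k(\mathrm{tr}(Y_kW)+P^d_k)^2+c^1_k(\mathrm{tr}(Y_kW)+P^d_k)+c^0_k$. $\mathcal S^n$ is the space of real symmetric $n\times n$ matrices. Problem [LL]: minimise $\sum_{k\in G}f_k(W)$ over $W\in\mathcal S^n$, $W\succeq0$, subject to $P_k^{\min}\le\mathrm{tr}(Y_kW)+P_k^d\le P_k^{\max}$ and $Q_k^{\min}\le\mathrm{tr}(\bar Y_kW)+Q_k^d\le Q_k^{\max}$ for $k\in G$; $P_k^d=\mathrm{tr}(Y_kW)$ and $Q_k^d=\mathrm{tr}(\bar Y_kW)$ for $k\in N\setminus G$; $(V_k^{\min})^2\le\mathrm{tr}(M_kW)\le(V_k^{\max})^2$ for $k\in N$; $(\mathrm{tr}(Y_{lm}W))^2+(\mathrm{tr}(\bar Y_{lm}W))^2\le(S_{lm}^{\max})^2$ for $(l,m)\in L$. Problem [PP4]: minimise $\sum_{k\in G}f_k(xx^T)$ over $x\in\mathbb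 R^n$ such that $W=xx^T$ satisfies all the constraints just listed for [LL]. Problem [R$r$BC] (for an integer $r\ge1$; the cases $r=1,2$ are used): minimise $\sum_{k\in G}f_k(W)$ over $W\in\mathcal S^n$ and real $t_k,g_k,h_k$ ($k\in N$), $u_{lm},v_{lm},z_{lm}$ ($(l,m)\in L$) subject to: $t_k=\mathrm{tr}(Y_kW)$, $g_k=\mathrm{tr}(\bar Y_kW)$, $h_k=\mathrm{tr}(M_kW)$ for $k\in N$; $P_k^{\min}-P_k^d\le t_k\le P_k^{\max}-P_k^d$ and $Q_k^{\min}-Q_k^d\le g_k\le Q_k^{\max}-Q_k^d$ for $k\in G$; $t_k=P_k^d$ and $g_k=Q_k^d$ for $k\in N\setminus G$; $(V_k^{\min})^2\le h_k\le(V_k^{\max})^2$ for $k\in N$; $u_{lm}=\mathrm{tr}(Y_{lm}W)$, $v_{lm}=\mathrm{tr}(\bar Y_{lm}W)$, $z_{lm}=u_{lm}^2+v_{lm}^2$, $z_{lm}\le(S_{lm}^{\max})^2$ for $(l,m)\in L$; $W\succeq0$, $\mathrm{rank}(W)\le r$. Since the other variables are determined by $W$, one speaks of $W$ itself as feasible, or as a local or global optimum, of [R$r$BC]. Augmented Lagrangian. For multipliers $\lambda^t,\lambda^g,\lambda^h,\lambda^u,\lambda^v,\lambda^z$ and parameters $\mu,\nu>0$, $\mathcal L$ is $\sum_{k\in G}f_k(RR^T)+\nu\mathcal R$ plus, for each constraint residual $\rho$ with its multiplier $\lambda$, the term $-\lambda\rho+\tfrac\mu2\rho^2$, where the residuals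 are $t_k-\mathrm{tr}(Y_kRR^T)$, $g_k-\mathrm{tr}(\bar Y_kRR^T)$, $h_k-\mathrm{tr}(M_kRR^T)$ ($k\in N$) and $u_{lm}-\mathrm{tr}(Y_{lm}RR^T)$, $v_{lm}-\mathrm{tr}(\bar Y_{lm}RR^T)$, $z_{lm}-u_{lm}^2-v_{lm}^2$ ($(l,m)\in L$). The regulariser $\mathcal R$ is $\det(R^TR)$ or $0$. $T_k(R^{(k)})$ denotes the sum of the squares of all these residuals at inner iteration $k$, evaluated at $R=R^{(k)}$ and the current $t,g,h,u,v,z$, where the current $t,g,h,z$ satisfy their box constraints in [R$r$BC]. Algorithm. An outer loop runs over $r=1,2,\dots$. For each $r$: choose $R\in\mathbb R^{n\times r}$; compute the corresponding values of $t,h,g,u,v,z$ and project them onto the box constraints; then for $k=0,1,2,\dots$ (inner loop): minimise $\mathcal L$ coordinate-wise in $t,g,h,u,v,z$ (respecting box constraints); minimise $\mathcal L$ coordinate-wise in $R$, each scalar coordinate being updated to an exact minimiser with the others fixed; update the Lagrange multipliers; update $\mu=\mu_k>0$ (and $\nu=\nu_k$); terminate if termination criteria are met. $R^{(k)}$ is the value of $R$ at the $k$-th inner iteration. *)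

theory Defs
  imports "HOL-Analysis.Analysis"
begin

text \<open>The buses are the elements of a finite type \<open>'n\<close>, and the index set of \<open>\<real>\<^sup>n\<close>
  with \<open>n = 2|N|\<close> is \<open>'n + 'n\<close>: \<open>Inl\<close> indexes the first block and \<open>Inr\<close> the second one.\<close>

record ('n::finite) acopf =
  gens :: "'n set"
  branches :: "('n \<times> 'n) set"
  c0 :: "'n \<Rightarrow> real"
  c1 :: "'n \<Rightarrow> real"
  c2 :: "'n \<Rightarrow> real"
  Pd :: "'n \<Rightarrow> real"
  Qd :: "'n \<Rightarrow> real"
  Pmin :: "'n \<Rightarrow> real"
  Pmax :: "'n \<Rightarrow> real"
  Qmin :: "'n \<Rightarrow> real"
  Qmax :: "'n \<Rightarrow> real"
  Vmin :: "'n \<Rightarrow> real"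
  Vmax :: "'n \<Rightarrow> real"
  Smax :: "'n \<times> 'n \<Rightarrow> real"
  bbar :: "'n \<times> 'n \<Rightarrow> real"
  gser :: "'n \<times> 'n \<Rightarrow> real"
  bser :: "'n \<times> 'n \<Rightarrow> real"
  admittance :: "complex^'n^'n"

type_synonym 'n sqmat = "real^('n + 'n)^('n + 'n)"

definition outer :: "'a::semiring_1^'n \<Rightarrow> 'a^'m \<Rightarrow> 'a^'m^'n" where
  "outer a b = (\<chi> i j. a $ i * b $ j)"

definition E :: "'n::finite \<Rightarrow> 'n \<Rightarrow> 'a::semiring_1^'n^'n" where
  "E k l = outer (axis k 1) (axis l 1)"

definition block :: "real^'n^'n \<Rightarrow> real^'n^'n \<Rightarrow> real^'n^'n \<Rightarrow> real^'n^'n \<Rightarrow> ('n::finite) sqmat" where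
  "block A B C D = (\<chi> i j. case i of
      Inl p \<Rightarrow> (case j of Inl q \<Rightarrow> A $ p $ q | Inr q \<Rightarrow> B $ p $ q)
    | Inr p \<Rightarrow> (case j of Inl q \<Rightarrow> C $ p $ q | Inr q \<Rightarrow> D $ p $ q))"

definition Ymat :: "complex^'n^'n \<Rightarrow> ('n::finite) sqmat" where
  "Ymat A = (1/2) *\<^sub>R block (map_matrix Re (A + transpose A)) (map_matrix Im (transpose A - A))
                           (map_matrix Im (A - transpose A)) (map_matrix Re (A + transpose A))"

definition Ybarmat :: "complex^'n^'n \<Rightarrow> ('n::finite) sqmat" where
  "Ybarmat A = - (1/2) *\<^sub>R block (map_matrix Im (A + transpose A)) (map_matrix Re (A - transpose A))
                               (map_matrix Re (transpose A - A)) (map_matrix Im (A + transpose A))"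

definition ybus :: "('n::finite) acopf \<Rightarrow> 'n \<Rightarrow> complex^'n^'n" where
  "ybus I k = E k k ** admittance I"

definition ybranch :: "('n::finite) acopf \<Rightarrow> 'n \<times> 'n \<Rightarrow> complex^'n^'n" where
  "ybranch I = (\<lambda>(l, m).
     (let s = complex_of_real (gser I (l, m)) + \<i> * complex_of_real (bser I (l, m))
      in mat (\<i> * complex_of_real (bbar I (l, m) / 2) + s) ** E l l - mat s ** E l m))"

definition trY :: "('n::finite) acopf \<Rightarrow> 'n \<Rightarrow> 'n sqmat \<Rightarrow> real" where
  "trY I k W = trace (Ymat (ybus I k) ** W)"

definition trYbar :: "('n::finite) acopf \<Rightarrow> 'n \<Rightarrow> 'n sqmat \<Rightarrow> real" where
  "trYbar I k W = trace (Ybarmat (ybus I k) ** W)"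

definition trM :: "'n::finite \<Rightarrow> 'n sqmat \<Rightarrow> real" where
  "trM k W = trace (block (E k k) 0 0 (E k k) ** W)"

definition trYbr :: "('n::finite) acopf \<Rightarrow> 'n \<times> 'n \<Rightarrow> 'n sqmat \<Rightarrow> real" where
  "trYbr I e W = trace (Ymat (ybranch I e) ** W)"

definition trYbarbr :: "('n::finite) acopf \<Rightarrow> 'n \<times> 'n \<Rightarrow> 'n sqmat \<Rightarrow> real" where
  "trYbarbr I e W = trace (Ybarmat (ybranch I e) ** W)"

definition psd :: "real^'m^'m \<Rightarrow> bool" where
  "psd W \<longleftrightarrow> transpose W = W \<and> (\<forall>x. 0 \<le> x \<bullet> (W *v x))"

definition cost :: "('n::finite) acopf \<Rightarrow> 'n sqmat \<Rightarrow> real" where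
  "cost I W = (\<Sum>k\<in>gens I. c2 I k * (trY I k W + Pd I k)^2 + c1 I k * (trY I k W + Pd I k) + c0 I k)"

definition opf_constraints :: "('n::finite) acopf \<Rightarrow> 'n sqmat \<Rightarrow> bool" where
  "opf_constraints I W \<longleftrightarrow>
     (\<forall>k\<in>gens I. Pmin I k \<le> trY I k W + Pd I k \<and> trY I k W + Pd I k \<le> Pmax I k
        \<and> Qmin I k \<le> trYbar I k W + Qd I k \<and> trYbar I k W + Qd I k \<le> Qmax I k)
   \<and> (\<forall>k. k \<notin> gens I \<longrightarrow> Pd I k = trY I k W \<and> Qd I k = trYbar I k W)
   \<and> (\<forall>k. (Vmin I k)^2 \<le> trM k W \<and> trM k W \<le> (Vmax I k)^2)
   \<and> (\<forall>e\<in>branches I. (trYbr I e W)^2 + (trYbarbr I e W)^2 \<le> (Smax I e)^2)"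

definition LL_feasible :: "('n::finite) acopf \<Rightarrow> 'n sqmat \<Rightarrow> bool" where
  "LL_feasible I W \<longleftrightarrow> psd W \<and> opf_constraints I W"

definition LL_optimum :: "('n::finite) acopf \<Rightarrow> 'n sqmat \<Rightarrow> bool" where
  "LL_optimum I = is_arg_min (cost I) (LL_feasible I)"

definition PP4_feasible :: "('n::finite) acopf \<Rightarrow> real^('n + 'n) \<Rightarrow> bool" where
  "PP4_feasible I x \<longleftrightarrow> opf_constraints I (outer x x)"

definition PP4_global_optimum :: "('n::finite) acopf \<Rightarrow> real^('n + 'n) \<Rightarrow> bool" where
  "PP4_global_optimum I = is_arg_min (\<lambda>x. cost I (outer x x)) (PP4_feasible I)"

text \<open>Names of the scalar variables \<open>t\<^sub>k, g\<^sub>k, h\<^sub>k, u\<^sub>l\<^sub>m, v\<^sub>l\<^sub>m, z\<^sub>l\<^sub>m\<close>. Each is the leading term of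
  exactly one constraint residual, so the same names index residuals and Lagrange multipliers.
  Only the names in \<open>avars I\<close> are variables of the instance \<open>I\<close>; values at other
  names are never read.\<close>

datatype 'n avar = T 'n | G 'n | H 'n | U "'n \<times> 'n" | V "'n \<times> 'n" | Z "'n \<times> 'n"

definition avars :: "('n::finite) acopf \<Rightarrow> 'n avar set" where
  "avars I = range T \<union> range G \<union> range H \<union> U ` branches I \<union> V ` branches I \<union> Z ` branches I"

fun bounds :: "('n::finite) acopf \<Rightarrow> 'n avar \<Rightarrow> real set" where
  "bounds I (T k) = (if k \<in> gens I then {Pmin I k - Pd I k .. Pmax I k - Pd I k} else {Pd I k})"
| "bounds I (G k) = (if k \<in> gens I then {Qmin I k - Qd I k .. Qmax I k - Qd I k} else {Qd I k})"
| "bounds I (H k) = {(Vmin I k)^2 .. (Vmax I k)^2}"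
| "bounds I (U e) = UNIV"
| "bounds I (V e) = UNIV"
| "bounds I (Z e) = {.. (Smax I e)^2}"

fun residual :: "('n::finite) acopf \<Rightarrow> 'n sqmat \<Rightarrow> ('n avar \<Rightarrow> real) \<Rightarrow> 'n avar \<Rightarrow> real" where
  "residual I W a (T k) = a (T k) - trY I k W"
| "residual I W a (G k) = a (G k) - trYbar I k W"
| "residual I W a (H k) = a (H k) - trM k W"
| "residual I W a (U e) = a (U e) - trYbr I e W"
| "residual I W a (V e) = a (V e) - trYbarbr I e W"
| "residual I W a (Z e) = a (Z e) - (a (U e))^2 - (a (V e))^2"

definition RBC_feasible_point ::
    "('n::finite) acopf \<Rightarrow> nat \<Rightarrow> 'n sqmat \<Rightarrow> ('n avar \<Rightarrow> real) \<Rightarrow> bool" where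
  "RBC_feasible_point I r W a \<longleftrightarrow>
     (\<forall>c\<in>avars I. residual I W a c = 0 \<and> a c \<in> bounds I c) \<and> psd W \<and> rank W \<le> r"

text \<open>The other variables and the cost are determined by \<open>W\<close> (continuously), so feasibility
  and optimality are properties of \<open>W\<close>.\<close>

definition RBC_feasible :: "('n::finite) acopf \<Rightarrow> nat \<Rightarrow> 'n sqmat \<Rightarrow> bool" where
  "RBC_feasible I r W \<longleftrightarrow> (\<exists>a. RBC_feasible_point I r W a)"

definition RBC_global_optimum :: "('n::finite) acopf \<Rightarrow> nat \<Rightarrow> 'n sqmat \<Rightarrow> bool" where
  "RBC_global_optimum I r = is_arg_min (cost I) (RBC_feasible I r)"

definition RBC_local_optimum :: "('n::finite) acopf \<Rightarrow> nat \<Rightarrow> 'n sqmat \<Rightarrow> bool" where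
  "RBC_local_optimum I r W \<longleftrightarrow>
     (\<exists>\<epsilon>>0. is_arg_min (cost I) (\<lambda>W'. RBC_feasible I r W' \<and> W' \<in> ball W \<epsilon>) W)"

definition gram :: "real^'r^'m \<Rightarrow> real^'m^'m" where
  "gram R = R ** transpose R"

definition aug_lagrangian :: "('n::finite) acopf \<Rightarrow> (real^'r^('n + 'n) \<Rightarrow> real) \<Rightarrow>
    ('n avar \<Rightarrow> real) \<Rightarrow> real \<Rightarrow> real \<Rightarrow> real^'r^('n + 'n) \<Rightarrow> ('n avar \<Rightarrow> real) \<Rightarrow> real" where
  "aug_lagrangian I reg lam \<mu> \<nu> R a = cost I (gram R) + \<nu> * reg R
     + (\<Sum>c\<in>avars I. - lam c * residual I (gram R) a c + \<mu> / 2 * (residual I (gram R) a c)^2)"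

definition infeasibility :: "('n::finite) acopf \<Rightarrow> real^'r^('n + 'n) \<Rightarrow> ('n avar \<Rightarrow> real) \<Rightarrow> real" where
  "infeasibility I R a = (\<Sum>c\<in>avars I. (residual I (gram R) a c)^2)"

text \<open>Values of the variables corresponding to \<open>W = R R\<^sup>T\<close> (making all residuals vanish).\<close>

fun induced :: "('n::finite) acopf \<Rightarrow> 'n sqmat \<Rightarrow> 'n avar \<Rightarrow> real" where
  "induced I W (T k) = trY I k W"
| "induced I W (G k) = trYbar I k W"
| "induced I W (H k) = trM k W"
| "induced I W (U e) = trYbr I e W"
| "induced I W (V e) = trYbarbr I e W"
| "induced I W (Z e) = (trYbr I e W)^2 + (trYbarbr I e W)^2"

text \<open>\<open>cd_pass F B cs x x'\<close>: starting from \<open>x\<close>, the coordinates in the list \<open>cs\<close> are updated one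
  after the other, each to an exact minimiser of \<open>F\<close> over its admissible set, ending in \<open>x'\<close>.\<close>

inductive cd_pass :: "(('c \<Rightarrow> real) \<Rightarrow> real) \<Rightarrow> ('c \<Rightarrow> real set) \<Rightarrow> 'c list \<Rightarrow>
    ('c \<Rightarrow> real) \<Rightarrow> ('c \<Rightarrow> real) \<Rightarrow> bool" for F B where
  cd_Nil: "cd_pass F B [] x x"
| cd_Cons: "is_arg_min (\<lambda>s. F (x(c := s))) (\<lambda>s. s \<in> B c) s \<Longrightarrow> cd_pass F B cs (x(c := s)) x'
    \<Longrightarrow> cd_pass F B (c # cs) x x'"

definition of_entries :: "('m \<times> 'r \<Rightarrow> real) \<Rightarrow> real^'r^'m" where
  "of_entries x = (\<chi> i j. x (i, j))"

definition entries :: "real^'r^'m \<Rightarrow> 'm \<times> 'r \<Rightarrow> real" where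
  "entries R = (\<lambda>(i, j). R $ i $ j)"

text \<open>\<open>lrcd I reg k R a lam \<mu> \<nu>\<close>: for the fixed number \<open>CARD('r)\<close> of columns, the inner loop can reach,
  after \<open>k\<close> iterations, the values \<open>R\<close>, \<open>a\<close>, \<open>lam\<close>, \<open>\<mu>\<close>, \<open>\<nu>\<close>. The algorithm leaves open the starting
  point, the order (and repetition) of coordinates within a pass, the rules updating \<open>lam\<close>,
  \<open>\<mu>\<close>, \<open>\<nu>\<close> and the termination criteria; the relation admits every choice of them.\<close>

inductive lrcd :: "('n::finite) acopf \<Rightarrow> (real^'r^('n + 'n) \<Rightarrow> real) \<Rightarrow> nat \<Rightarrow>
    real^'r^('n + 'n) \<Rightarrow> ('n avar \<Rightarrow> real) \<Rightarrow> ('n avar \<Rightarrow> real) \<Rightarrow> real \<Rightarrow> real \<Rightarrow> bool" for I reg where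
  lrcd_start: "0 < \<mu> \<Longrightarrow> 0 < \<nu> \<Longrightarrow>
    lrcd I reg 0 R (\<lambda>c. closest_point (bounds I c) (induced I (gram R) c)) lam \<mu> \<nu>"
| lrcd_step: "lrcd I reg k R a lam \<mu> \<nu> \<Longrightarrow>
    set cs = avars I \<Longrightarrow> cd_pass (aug_lagrangian I reg lam \<mu> \<nu> R) (bounds I) cs a a' \<Longrightarrow>
    set ds = UNIV \<Longrightarrow>
    cd_pass (\<lambda>x. aug_lagrangian I reg lam \<mu> \<nu> (of_entries x) a') (\<lambda>_. UNIV) ds (entries R) (entries R') \<Longrightarrow>
    0 < \<mu>' \<Longrightarrow> 0 < \<nu>' \<Longrightarrow>
    lrcd I reg (Suc k) R' a' lam' \<mu>' \<nu>'"

definition append_zero_column :: "real^1^'m \<Rightarrow> real^2^'m" where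
  "append_zero_column R = (\<chi> i j. if j = 1 then R $ i $ 1 else 0)"

end

theory Submission
  imports Defs
begin

text \<open>The rank bound is the only non-convex part of the problem: since \<open>c\<^sup>2\<^sub>k \<ge> 0\<close>, the problem
  without it (the relaxation, whose feasible set is \<^term>\<open>LL_feasible\<close>) is convex, and a matrix is
  feasible for the rank-\<open>r\<close> problem iff it is feasible for the relaxation and has rank at most \<open>r\<close>
  (\<open>RBC_feasible_iff\<close>). The points \<open>W = R R\<^sup>T\<close> and the rank-one optimum \<open>W\<^sup>*\<close> of the
  relaxation both have rank at most \<open>1\<close>, so by subadditivity of the rank the whole segment
  between them stays inside the feasible set of the rank-\<open>2\<close> problem. Along this segment the
  cost is convex, and \<open>W\<close> is a local minimum of it; were the cost of \<open>W\<^sup>*\<close> smaller, points of the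
  segment arbitrarily close to \<open>W\<close> would be cheaper than \<open>W\<close>. Hence \<open>W\<close> is optimal for the
  relaxation (\<open>local_min_le_of_segment\<close>). Both problems in the conclusion minimise the same
  cost over matrices feasible for the relaxation (for the one in the vector \<open>x\<close>, over the
  matrices \<open>x x\<^sup>T\<close>), so \<open>W\<close>, which is feasible for both, is optimal for both.

  Padding \<open>R\<close> with a zero column does not change \<open>R R\<^sup>T\<close>, so the local optimality hypothesis
  concerns \<open>W\<close> itself and already contains its feasibility.\<close>

section \<open>Rank and Gram matrices\<close>

lemma rank_add_le:
  fixes A B :: "real^'n^'m"
  shows "rank (A + B) \<le> rank A + rank B"
proof -
  obtain S where S: "range ((*v) A) \<subseteq> span S" "card S = rank A" "independent S"
    using basis_exists[of "range ((*v) A)"] by (metis rank_dim_range)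
  obtain T where T: "range ((*v) B) \<subseteq> span T" "card T = rank B" "independent T"
    using basis_exists[of "range ((*v) B)"] by (metis rank_dim_range)
  have "finite S" "finite T"
    using S(3) T(3) by (auto dest: independent_imp_finite)
  have "range ((*v) (A + B)) \<subseteq> span (S \<union> T)"
  proof clarify
    fix x
    have "A *v x \<in> span (S \<union> T)" "B *v x \<in> span (S \<union> T)"
      using S(1) T(1) span_mono[of S "S \<union> T"] span_mono[of T "S \<union> T"] by blast+
    then show "(A + B) *v x \<in> span (S \<union> T)"
      by (simp add: matrix_vector_mult_add_rdistrib span_add)
  qed
  then have "rank (A + B) \<le> card (S \<union> T)"
    using \<open>finite S\<close> \<open>finite T\<close> by (simp add: rank_dim_range dim_le_card)
  also have "\<dots> \<le> rank A + rank B"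
    using card_Un_le[of S T] S(2) T(2) by simp
  finally show ?thesis .
qed

lemma rank_scaleR_le:
  fixes A :: "real^'n^'m"
  shows "rank (c *\<^sub>R A) \<le> rank A"
proof -
  have "c *\<^sub>R A = A ** (c *\<^sub>R mat 1)"
    by (metis matrix_mul_rid matrix_scalar_ac scalar_matrix_assoc)
  then show ?thesis
    using rank_mul_le_left by metis
qed

lemma rank_gram_le: "rank (gram (R :: real^'r^'m)) \<le> CARD('r)"
  using rank_mul_le_left[of R "transpose R"] rank_bound[of R] by (simp add: gram_def)

lemma psd_gram: "psd (gram (R :: real^'r^'m))"
  unfolding psd_def
proof (intro conjI allI)
  show "transpose (gram R) = gram R"
    by (simp add: gram_def matrix_transpose_mul)
  fix x :: "real^'m"
  have "x \<bullet> (gram R *v x) = (transpose R *v x) \<bullet> (transpose R *v x)"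
    using dot_lmul_matrix[of x R "transpose R *v x"]
    by (simp add: gram_def flip: matrix_vector_mul_assoc)
  then show "0 \<le> x \<bullet> (gram R *v x)"
    by simp
qed

lemma gram_append_zero_column: "gram (append_zero_column R) = gram R"
  by (simp add: gram_def append_zero_column_def matrix_matrix_mult_def transpose_def vec_eq_iff
      sum_2 sum_1)

lemma outer_column: "outer (column 1 R) (column 1 R) = gram (R :: real^1^'m)"
  by (simp add: outer_def gram_def column_def matrix_matrix_mult_def transpose_def vec_eq_iff sum_1)

lemma psd_outer: "psd (outer x (x :: real^'m))"
proof -
  have "column 1 (\<chi> i j. x $ i :: real^1^'m) = x"
    by (simp add: column_def vec_eq_iff)
  then show ?thesis
    using psd_gram outer_column by metis
qed

section \<open>Convexity of the relaxation\<close>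

lemma linear_trace_mul: "linear (\<lambda>W :: real^'n^'n. trace (A ** W))"
proof (rule linearI)
  show "trace (A ** (c *\<^sub>R W)) = c *\<^sub>R trace (A ** W)" for c and W :: "real^'n^'n"
    by (simp add: trace_def matrix_matrix_mult_def sum_distrib_left mult.left_commute)
qed (simp add: matrix_add_ldistrib trace_add)

lemma linear_tr:
  "linear (trY I k)" "linear (trYbar I k)" "linear (trM k)" "linear (trYbr I e)" "linear (trYbarbr I e)"
  unfolding trY_def[abs_def] trYbar_def[abs_def] trM_def[abs_def] trYbr_def[abs_def]
    trYbarbr_def[abs_def]
  by (rule linear_trace_mul)+

lemma convex_psd: "convex {W. psd W}"
proof (rule convexI, clarify)
  fix A B :: "real^'m^'m" and u v :: real
  assume "psd A" "psd B" "0 \<le> u" "0 \<le> v" "u + v = 1"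
  then show "psd (u *\<^sub>R A + v *\<^sub>R B)"
    by (auto simp: psd_def matrix_vector_mult_add_rdistrib inner_add_right transpose_def vec_eq_iff
        simp flip: scaleR_matrix_vector_assoc)
qed

lemma convex_on_affine_linear:
  assumes "linear f"
  shows "convex_on UNIV (\<lambda>x. f x + c :: real)"
proof (rule convex_onI)
  fix t :: real and x y
  have "f ((1 - t) *\<^sub>R x + t *\<^sub>R y) = (1 - t) * f x + t * f y"
    using assms by (simp add: linear_add linear_scale)
  then show "f ((1 - t) *\<^sub>R x + t *\<^sub>R y) + c \<le> (1 - t) * (f x + c) + t * (f y + c)"
    by (simp add: algebra_simps)
qed simp

lemma convex_on_square_affine_linear:
  fixes f :: "'a::real_vector \<Rightarrow> real"
  assumes "linear f"
  shows "convex_on UNIV (\<lambda>x. (f x + c)^2)"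
proof (rule convex_onI)
  fix t :: real and x y assume t: "0 < t" "t < 1"
  have "f ((1 - t) *\<^sub>R x + t *\<^sub>R y) = (1 - t) * f x + t * f y"
    using assms by (simp add: linear_add linear_scale)
  then have "f ((1 - t) *\<^sub>R x + t *\<^sub>R y) + c = (1 - t) * (f x + c) + t * (f y + c)"
    by (simp add: algebra_simps)
  then show "(f ((1 - t) *\<^sub>R x + t *\<^sub>R y) + c)^2 \<le> (1 - t) * (f x + c)^2 + t * (f y + c)^2"
    using convex_onD[OF convex_power2, of t "f x + c" "f y + c"] t by simp
qed simp

lemma convex_on_cost:
  assumes "\<forall>k\<in>gens I. 0 \<le> c2 I k"
  shows "convex_on UNIV (cost I)"
proof -
  define F where "F k W = c2 I k * (trY I k W + Pd I k)^2 + c1 I k * (trY I k W + Pd I k) + c0 I k"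
    for k W
  have F: "convex_on UNIV (F k)" if "k \<in> gens I" for k
  proof -
    have "linear (\<lambda>W. c1 I k * trY I k W)"
      using linear_compose_scale_right[OF linear_tr(1)[of I k]] by simp
    then have "convex_on UNIV (\<lambda>W. c2 I k * (trY I k W + Pd I k)^2
        + (c1 I k * trY I k W + (c1 I k * Pd I k + c0 I k)))"
      using assms that
      by (intro convex_on_add convex_on_cmul convex_on_square_affine_linear
          convex_on_affine_linear linear_tr) auto
    then show ?thesis
      by (simp add: F_def[abs_def] distrib_left add.assoc)
  qed
  have "convex_on UNIV (\<lambda>W. \<Sum>k\<in>K. F k W)" if "K \<subseteq> gens I" for K
    using finite[of K] that
  proof (induction K rule: finite_induct)
    case empty
    then show ?case by (simp add: convex_on_const)
  next
    case (insert k K)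
    then show ?case
      by (simp add: convex_on_add F)
  qed
  from this[OF subset_refl] show ?thesis
    by (simp add: cost_def[abs_def] F_def)
qed

lemma convex_opf_constraints: "convex {W. opf_constraints I W}"
proof (rule convexI, clarify)
  fix A B :: "'a sqmat" and u v :: real
  assume A: "opf_constraints I A" and B: "opf_constraints I B"
    and uv: "0 \<le> u" "0 \<le> v" "u + v = 1"
  have tr: "f (u *\<^sub>R A + v *\<^sub>R B) = u * f A + v * f B" if "linear f" for f :: "'a sqmat \<Rightarrow> real"
    using that by (simp add: linear_add linear_scale)
  have le: "u * x + v * y + d \<le> c" if "x + d \<le> c" "y + d \<le> c" for c d x y
    using convex_bound_le[of x "c - d" y u v] that uv by simp
  have ge: "c \<le> u * x + v * y + d" if "c \<le> x + d" "c \<le> y + d" for c d x y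
    using le[of "- x" "- d" "- c" "- y"] that by simp
  have eq: "c = u * x + v * y" if "c = x" "c = y" for c x y
    using that uv(3) by (simp flip: distrib_right)
  have sq: "(u * x + v * y)^2 \<le> u * x^2 + v * y^2" for x y :: real
    using convex_onD[OF convex_power2, of v x y] uv by (simp add: eq_diff_eq[symmetric])
  have disc: "(u * x + v * y)^2 + (u * x' + v * y')^2 \<le> c"
    if "x^2 + x'^2 \<le> c" "y^2 + y'^2 \<le> c" for x y x' y' c :: real
    using sq[of x y] sq[of x' y'] convex_bound_le[OF that uv] by (simp add: algebra_simps)
  show "opf_constraints I (u *\<^sub>R A + v *\<^sub>R B)"
    using A B unfolding opf_constraints_def linear_tr[THEN tr]
    by (auto intro!: le ge disc eq le[where d = 0, simplified] ge[where d = 0, simplified])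
qed

lemma convex_LL_feasible: "convex {W. LL_feasible I W}"
  unfolding LL_feasible_def Collect_conj_eq
  by (intro convex_Int convex_psd convex_opf_constraints)

section \<open>From the rank-constrained problem to the relaxation\<close>

lemma RBC_feasible_iff: "RBC_feasible I r W \<longleftrightarrow> LL_feasible I W \<and> rank W \<le> r"
proof
  assume "RBC_feasible I r W"
  then obtain a where a: "\<And>c. c \<in> avars I \<Longrightarrow> residual I W a c = 0 \<and> a c \<in> bounds I c"
    and W: "psd W" "rank W \<le> r"
    by (auto simp: RBC_feasible_def RBC_feasible_point_def)
  have T: "a (T k) = trY I k W \<and> a (T k) \<in> bounds I (T k)"
    and G: "a (G k) = trYbar I k W \<and> a (G k) \<in> bounds I (G k)"
    and H: "a (H k) = trM k W \<and> a (H k) \<in> bounds I (H k)" for k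
    using a[of "T k"] a[of "G k"] a[of "H k"] by (auto simp: avars_def)
  have Z: "(trYbr I e W)^2 + (trYbarbr I e W)^2 \<le> (Smax I e)^2" if "e \<in> branches I" for e
    using a[of "U e"] a[of "V e"] a[of "Z e"] that by (simp add: avars_def)
  have "opf_constraints I W"
    unfolding opf_constraints_def
  proof (intro conjI ballI allI impI)
    fix k assume "k \<in> gens I"
    then show "Pmin I k \<le> trY I k W + Pd I k" "trY I k W + Pd I k \<le> Pmax I k"
      "Qmin I k \<le> trYbar I k W + Qd I k" "trYbar I k W + Qd I k \<le> Qmax I k"
      using T[of k] G[of k] by auto
  next
    fix k assume "k \<notin> gens I"
    then show "Pd I k = trY I k W" "Qd I k = trYbar I k W"
      using T[of k] G[of k] by auto
  next
    fix k
    show "(Vmin I k)^2 \<le> trM k W" "trM k W \<le> (Vmax I k)^2"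
      using H[of k] by auto
  qed (use Z in auto)
  with W show "LL_feasible I W \<and> rank W \<le> r"
    by (simp add: LL_feasible_def)
next
  assume W: "LL_feasible I W \<and> rank W \<le> r"
  then have "residual I W (induced I W) c = 0 \<and> induced I W c \<in> bounds I c" if "c \<in> avars I" for c
    using that by (cases c) (auto simp: avars_def LL_feasible_def opf_constraints_def algebra_simps)
  with W show "RBC_feasible I r W"
    unfolding RBC_feasible_def RBC_feasible_point_def LL_feasible_def by blast
qed

text \<open>The set \<open>S\<close> need not be convex: it only has to contain the segment from the local minimum
  to the point with which it is compared.\<close>

lemma local_min_le_of_segment:
  fixes f :: "'a::real_normed_vector \<Rightarrow> real"
  assumes f: "convex_on UNIV f"
    and segment: "closed_segment x y \<subseteq> S"
    and "0 < \<epsilon>" and local_min: "\<And>w. w \<in> S \<Longrightarrow> w \<in> ball x \<epsilon> \<Longrightarrow> f x \<le> f w"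
  shows "f x \<le> f y"
proof -
  \<comment> \<open>The denominator keeps \<open>t * norm (y - x) < \<epsilon>\<close>, and it is positive also when \<open>x = y\<close>.\<close>
  define t where "t = \<epsilon> / (\<epsilon> + norm (y - x))"
  have pos: "0 < \<epsilon> + norm (y - x)"
    using \<open>0 < \<epsilon>\<close> by (simp add: add_pos_nonneg)
  have t: "0 < t" "t \<le> 1"
    using \<open>0 < \<epsilon>\<close> pos by (auto simp: t_def divide_simps)
  have close: "t * norm (y - x) < \<epsilon>"
    using \<open>0 < \<epsilon>\<close> pos by (simp add: t_def field_simps)
  define w where "w = (1 - t) *\<^sub>R x + t *\<^sub>R y"
  have "w \<in> S"
    using segment t unfolding w_def closed_segment_def by fastforce
  moreover have "w \<in> ball x \<epsilon>"
  proof -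
    have "w - x = t *\<^sub>R (y - x)"
      by (simp add: w_def algebra_simps)
    then show ?thesis
      using close t by (simp add: dist_norm norm_minus_commute[of x w])
  qed
  ultimately have "f x \<le> f w"
    by (rule local_min)
  also have "f w \<le> (1 - t) * f x + t * f y"
    unfolding w_def using convex_onD[OF f, of t x y] t by simp
  finally have "t * f x \<le> t * f y"
    by (simp add: algebra_simps)
  with t show ?thesis
    by simp
qed

theorem proposition6p4:
  fixes I :: "('n::finite) acopf"
    and reg :: "real^1^('n + 'n) \<Rightarrow> real"
    and R :: "real^1^('n + 'n)"
    and a lam :: "'n avar \<Rightarrow> real"
    and \<mu> \<nu> :: real
    and k :: nat
  assumes "\<exists>x. PP4_feasible I x"
    and "\<exists>W. LL_optimum I W \<and> rank W = 1"
    and "\<forall>i\<in>gens I. 0 \<le> c2 I i"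
    and "reg = (\<lambda>R. det (transpose R ** R)) \<or> reg = (\<lambda>R. 0)"
    and "lrcd I reg k R a lam \<mu> \<nu>"
    and "infeasibility I R a = 0"
    and "RBC_local_optimum I 2 (gram (append_zero_column R))"
  shows "RBC_global_optimum I 1 (gram R) \<and> PP4_global_optimum I (column 1 R)"
proof -
  let ?W = "gram R"
  obtain W' where W': "LL_feasible I W'" "rank W' = 1"
    and opt: "\<And>w. LL_feasible I w \<Longrightarrow> cost I W' \<le> cost I w"
    using assms(2) by (auto simp: LL_optimum_def is_arg_min_linorder)
  obtain \<epsilon> where "0 < \<epsilon>" and W: "RBC_feasible I 2 ?W"
    and local_min: "\<And>w. RBC_feasible I 2 w \<Longrightarrow> w \<in> ball ?W \<epsilon> \<Longrightarrow> cost I ?W \<le> cost I w"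
    using assms(7) unfolding RBC_local_optimum_def gram_append_zero_column is_arg_min_linorder
    by blast
  have LL: "LL_feasible I ?W" and rank: "rank ?W \<le> 1"
    using W rank_gram_le[of R] by (simp_all add: RBC_feasible_iff)
  have "closed_segment ?W W' \<subseteq> {w. RBC_feasible I 2 w}"
  proof
    fix w assume w: "w \<in> closed_segment ?W W'"
    have "LL_feasible I w"
      using closed_segment_subset[OF _ _ convex_LL_feasible] LL W'(1) w by blast
    obtain t where t: "w = (1 - t) *\<^sub>R ?W + t *\<^sub>R W'"
      using w by (auto simp: closed_segment_def)
    have "rank w \<le> rank ((1 - t) *\<^sub>R ?W) + rank (t *\<^sub>R W')"
      unfolding t by (rule rank_add_le)
    also have "\<dots> \<le> rank ?W + rank W'"
      by (intro add_mono rank_scaleR_le)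
    finally have "rank w \<le> 2"
      using rank W'(2) by simp
    with \<open>LL_feasible I w\<close> show "w \<in> {w. RBC_feasible I 2 w}"
      by (simp add: RBC_feasible_iff)
  qed
  then have "cost I ?W \<le> cost I W'"
    using local_min_le_of_segment[OF convex_on_cost[OF assms(3)] _ \<open>0 < \<epsilon>\<close>] local_min by blast
  then have optimal: "cost I ?W \<le> cost I w" if "LL_feasible I w" for w
    using opt[OF that] by simp
  have "RBC_global_optimum I 1 ?W"
    using LL rank optimal by (simp add: RBC_global_optimum_def is_arg_min_linorder RBC_feasible_iff)
  moreover have "PP4_global_optimum I (column 1 R)"
    using LL optimal psd_outer
    by (auto simp: PP4_global_optimum_def is_arg_min_linorder PP4_feasible_def outer_column
        LL_feasible_def)
  ultimately show ?thesis ..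
qed

end
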